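(* Let $\mathbf{X}\in\mathbb{R}^{n\times p}$ be a fixed matrix of full column rank $p<n$, let $\mathbf{y}\in\mathbb{R}^n$ be a fixed vector with $SSR_F>0$, let $k>p$, and let $\mathbf{S}$ be a $k\times n$ Gaussian sketching matrix. Then, under the randomness of $\mathbf{S}$ alone, the complete sketch estimator $\boldsymbol{\beta}_s$ and the sketched residual sum of squares $SSR_s$ are independent, and $$\frac{SSR_s}{SSR_F/k}\sim\chi^2_{k-p}.$$
   Context: A Gaussian sketching matrix $\mathbf{S}$ of size $k\times n$ has independent entries $\mathbf{S}_{ij}\sim N(0,1/k)$. The sketched data are $\mathbf{X}_s=\mathbf{S}\mathbf{X}$ and $\mathbf{y}_s=\mathbf{S}\mathbf{y}$. The complete sketch estimator is $\boldsymbol{\beta}_s=(\mathbf{X}_s^{\mathsf T}\mathbf{X}_s)^{-1}\mathbf{X}_s^{\mathsf T}\mathbf{y}_s$ (defined almost surely). The residual sums of squares are $SSR_F=\mathbf{y}^{\mathsf T}\{\mathbf{I}-\mathbf{X}(\mathbf{X}^{\mathsf T}\mathbf{X})^{-1}\mathbf{X}^{\mathsf T}\}\mathbf{y}$ (full data) and $SSR_s=\mathbf{y}_s^{\mathsf T}\{\mathbf{I}-\mathbf{X}_s(\mathbf{X}_s^{\mathsf T}\mathbf{X}_s)^{-1}\mathbf{X}_s^{\mathsf T}\}\mathbf{y}_s$ (sketched data). *)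

theory Defs
  imports "HOL-Probability.Probability"
begin

definition gaussian_sketch :: "'a measure \<Rightarrow> ('a \<Rightarrow> real^'n^'k) \<Rightarrow> bool" where
  "gaussian_sketch M S \<longleftrightarrow>
     prob_space.indep_vars M (\<lambda>_. borel) (\<lambda>(i, j) \<omega>. S \<omega> $ i $ j) UNIV \<and>
     (\<forall>i j. distributed M lborel (\<lambda>\<omega>. S \<omega> $ i $ j)
              (normal_density 0 (sqrt (1 / real CARD('k)))))"

text \<open>The two definitions below are applied both to the full data and to the sketched data.
  If the Gram matrix is singular, \<^const>\<open>matrix_inv\<close> returns a fixed
  unspecified matrix; for a Gaussian sketch of a matrix of full column rank, with at least as
  many rows as columns, this happens only on a null set.\<close>

definition least_squares :: "real^'p^'m \<Rightarrow> real^'m \<Rightarrow> real^'p" where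
  "least_squares X y = matrix_inv (transpose X ** X) *v (transpose X *v y)"

definition SSR :: "real^'p^'m \<Rightarrow> real^'m \<Rightarrow> real" where
  "SSR X y = y \<bullet> ((mat 1 - X ** matrix_inv (transpose X ** X) ** transpose X) *v y)"

text \<open>The library's \<^term>\<open>prob_space.indep_var\<close> requires both random variables to
  have the same value type. This is the characterization \<open>indep_var_eq\<close> with the two
  value types allowed to differ.\<close>

definition indep_rvs ::
  "'a measure \<Rightarrow> 'b measure \<Rightarrow> ('a \<Rightarrow> 'b) \<Rightarrow> 'c measure \<Rightarrow> ('a \<Rightarrow> 'c) \<Rightarrow> bool" where
  "indep_rvs M N1 X N2 Y \<longleftrightarrow>
     X \<in> measurable M N1 \<and> Y \<in> measurable M N2 \<and>
     prob_space.indep_set M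
       (sigma_sets (space M) {X -` A \<inter> space M | A. A \<in> sets N1})
       (sigma_sets (space M) {Y -` B \<inter> space M | B. B \<in> sets N2})"

text \<open>The chi-squared distribution with \<open>m\<close> degrees of freedom: the law of the sum of the
  squares of \<open>m\<close> independent standard normal variables.\<close>

definition chi_squared :: "nat \<Rightarrow> real measure" where
  "chi_squared m =
     distr (\<Pi>\<^sub>M i\<in>{..<m}. density lborel std_normal_density) borel
       (\<lambda>z. \<Sum>i<m. (z i)\<^sup>2)"

end

theory Submission
  imports Defs
begin

text \<open>Write \<open>y = X \<beta> + \<sigma> e\<close> with \<open>e\<close> a unit vector orthogonal to the columns of \<open>X\<close>, so that
  \<open>\<sigma>\<^sup>2 = SSR\<^sub>F\<close>. As \<open>X\<^sup>T e = 0\<close>, rotation invariance of the Gaussian law makes \<open>W = S X\<close> independent of the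
  standard Gaussian vector \<open>z = \<surd>k S e\<close>. With \<open>c = \<sigma> / \<surd>k\<close>, the sketched regression is that of
  \<open>W \<beta> + c z\<close> on \<open>W\<close>: its estimator is \<open>\<beta>\<close> plus \<open>c\<close> times that of \<open>z\<close>, and its residual sum of
  squares is \<open>c\<^sup>2\<close> times that of \<open>z\<close>. For each \<open>W\<close> of full rank the first depends only on the projection of
  \<open>z\<close> to the range of \<open>W\<close>, the second is the squared norm of the projection to the orthogonal
  complement, hence chi-squared with a law not depending on \<open>W\<close>. Integrating over \<open>W\<close>, which has full
  rank almost surely, gives the claim.\<close>

section \<open>Least squares\<close>

lemma borel_measurable_vec_nth [measurable (raw)]:
  fixes f :: "'a \<Rightarrow> 'b::euclidean_space^'n"
  assumes "f \<in> borel_measurable M"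
  shows "(\<lambda>x. f x $ i) \<in> borel_measurable M"
  using assms by (rule borel_measurable_continuous_on[rotated]) (intro continuous_intros)

lemma borel_measurable_vec_lambda [measurable (raw)]:
  fixes f :: "'a \<Rightarrow> 'n::finite \<Rightarrow> 'b::euclidean_space"
  assumes "\<And>i. (\<lambda>x. f x i) \<in> borel_measurable M"
  shows "(\<lambda>x. \<chi> i. f x i) \<in> borel_measurable M"
proof (subst borel_measurable_euclidean_space, intro ballI)
  fix b :: "'b^'n"
  assume "b \<in> Basis"
  then obtain i u where "b = axis i u"
    by (auto simp: Basis_vec_def)
  thus "(\<lambda>x. (\<chi> i. f x i) \<bullet> b) \<in> borel_measurable M"
    using borel_measurable_inner[OF assms[of i] borel_measurable_const] by (simp add: inner_axis)
qed

lemma borel_measurable_matrix_mult [measurable (raw)]: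
  fixes f :: "'a \<Rightarrow> real^'n^'m" and g :: "'a \<Rightarrow> real^'p^'n"
  assumes [measurable]: "f \<in> borel_measurable M" "g \<in> borel_measurable M"
  shows "(\<lambda>x. f x ** g x) \<in> borel_measurable M"
  unfolding matrix_matrix_mult_def by measurable

lemma borel_measurable_matrix_vector_mult [measurable (raw)]:
  fixes f :: "'a \<Rightarrow> real^'n^'m" and g :: "'a \<Rightarrow> real^'n"
  assumes [measurable]: "f \<in> borel_measurable M" "g \<in> borel_measurable M"
  shows "(\<lambda>x. f x *v g x) \<in> borel_measurable M"
  unfolding matrix_vector_mult_def by measurable

lemma borel_measurable_transpose [measurable (raw)]:
  fixes f :: "'a \<Rightarrow> real^'n^'m"
  assumes [measurable]: "f \<in> borel_measurable M"
  shows "(\<lambda>x. transpose (f x)) \<in> borel_measurable M"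
  unfolding transpose_def by measurable

lemma borel_measurable_det [measurable (raw)]:
  fixes f :: "'a \<Rightarrow> real^'n^'n"
  assumes [measurable]: "f \<in> borel_measurable M"
  shows "(\<lambda>x. det (f x)) \<in> borel_measurable M"
  unfolding det_def by measurable

lemma matrix_inv_left_right:
  fixes A :: "real^'n^'n"
  assumes "invertible A"
  shows "A ** matrix_inv A = mat 1" "matrix_inv A ** A = mat 1"
  using someI_ex[OF assms[unfolded invertible_def]] unfolding matrix_inv_def by blast+

text \<open>Cramer's rule makes each entry a quotient of determinants, from which measurability
  follows. In the singular case the predicate under the choice operator is constantly false, so the
  default value is the same matrix for every singular \<open>A\<close>.\<close>

lemma matrix_inv_eq_cramer:
  fixes A :: "real^'n^'n"
  shows "matrix_inv A = (if det A = 0 then (SOME B::real^'n^'n. False)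
    else \<chi> k l. det (\<chi> i j. if j = k then axis l 1 $ i else A $ i $ j) / det A)"
proof (cases "det A = 0")
  case True
  hence "(\<lambda>B. A ** B = mat 1 \<and> B ** A = mat 1) = (\<lambda>_. False)"
    using invertible_det_nz[of A] unfolding invertible_def by blast
  thus ?thesis
    using True unfolding matrix_inv_def by simp
next
  case False
  hence "invertible A"
    by (simp add: invertible_det_nz)
  hence "A *v (matrix_inv A *v axis l 1) = axis l 1" for l
    by (simp add: matrix_vector_mul_assoc matrix_inv_left_right)
  hence "matrix_inv A *v axis l 1
      = (\<chi> k. det (\<chi> i j. if j = k then axis l 1 $ i else A $ i $ j) / det A)" for l
    by (simp add: cramer[OF False])
  hence "(matrix_inv A *v axis l 1) $ k
      = det (\<chi> i j. if j = k then axis l 1 $ i else A $ i $ j) / det A" for l k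
    by simp
  moreover have "(matrix_inv A *v axis l 1) $ k = matrix_inv A $ k $ l" for l k
    by (simp add: matrix_vector_mult_basis column_def)
  ultimately show ?thesis
    using False by (simp add: vec_eq_iff)
qed

lemma borel_measurable_matrix_inv [measurable (raw)]:
  fixes f :: "'a \<Rightarrow> real^'n^'n"
  assumes [measurable]: "f \<in> borel_measurable M"
  shows "(\<lambda>x. matrix_inv (f x)) \<in> borel_measurable M"
proof -
  have [measurable]: "(\<lambda>x. f x $ i $ j) \<in> borel_measurable M" for i j
    by measurable
  have "(\<lambda>x. if j = k then axis l 1 $ i else f x $ i $ j) \<in> borel_measurable M" for i j k l
    by (cases "j = k") auto
  hence "(\<lambda>x. det (\<chi> i j. if j = k then axis l 1 $ i else f x $ i $ j) / det (f x)) \<in> borel_measurable M" for k l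
    by (intro borel_measurable_divide borel_measurable_det borel_measurable_vec_lambda assms)
  hence "(\<lambda>x. (\<chi> k l. det (\<chi> i j. if j = k then axis l 1 $ i else f x $ i $ j) / det (f x))::real^'n^'n) \<in> borel_measurable M"
    by (intro borel_measurable_vec_lambda)
  moreover have "{x \<in> space M. det (f x) = 0} \<in> sets M"
    by measurable
  ultimately show ?thesis
    unfolding matrix_inv_eq_cramer by (intro measurable_If borel_measurable_const)
qed

lemma borel_measurable_least_squares [measurable (raw)]:
  fixes f :: "'a \<Rightarrow> real^'p^'m" and g :: "'a \<Rightarrow> real^'m"
  assumes [measurable]: "f \<in> borel_measurable M" "g \<in> borel_measurable M"
  shows "(\<lambda>x. least_squares (f x) (g x)) \<in> borel_measurable M"
  unfolding least_squares_def by measurable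

lemma borel_measurable_SSR [measurable (raw)]:
  fixes f :: "'a \<Rightarrow> real^'p^'m" and g :: "'a \<Rightarrow> real^'m"
  assumes [measurable]: "f \<in> borel_measurable M" "g \<in> borel_measurable M"
  shows "(\<lambda>x. SSR (f x) (g x)) \<in> borel_measurable M"
  unfolding SSR_def by measurable

section \<open>Normal equations and their behaviour under affine changes of the response\<close>

lemma invertible_Gram:
  fixes W :: "real^'p^'m"
  assumes "inj ((*v) W)"
  shows "invertible (transpose W ** W)"
proof -
  have "v = 0" if "(transpose W ** W) *v v = 0" for v
  proof -
    \<comment> \<open>The Gram matrix has the kernel of \<open>W\<close>, because its quadratic form
      is the squared norm of \<open>W *v v\<close>.\<close>
    have "(W *v v) \<bullet> (W *v v) = v \<bullet> ((transpose W ** W) *v v)"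
      by (metis dot_lmul_matrix inner_commute matrix_vector_mul_assoc transpose_matrix_vector)
    hence "W *v v = W *v 0"
      using that by simp
    thus ?thesis
      using assms by (rule injD[rotated])
  qed
  thus ?thesis
    by (metis invertible_left_inverse matrix_left_invertible_ker)
qed

text \<open>Expresses full column rank by a determinant, so that the set of full-rank designs is
  visibly Borel.\<close>

lemma inj_iff_det_Gram:
  fixes W :: "real^'p^'m"
  shows "inj ((*v) W) \<longleftrightarrow> det (transpose W ** W) \<noteq> 0"
proof
  assume "det (transpose W ** W) \<noteq> 0"
  hence "invertible (transpose W ** W)"
    by (simp add: invertible_det_nz)
  then obtain B where "B ** (transpose W ** W) = mat 1"
    unfolding invertible_def by blast
  hence "(B ** transpose W) ** W = mat 1"
    by (simp add: matrix_mul_assoc)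
  thus "inj ((*v) W)"
    using matrix_left_invertible_injective by blast
qed (use invertible_Gram invertible_det_nz in blast)

lemma least_squares_mult:
  fixes W :: "real^'p^'m"
  assumes "inj ((*v) W)"
  shows "least_squares W (W *v b) = b"
  using matrix_inv_left_right(2)[OF invertible_Gram[OF assms]]
  by (simp del: transpose_matrix_vector add: least_squares_def matrix_vector_mul_assoc matrix_mul_assoc)

lemma least_squares_affine:
  fixes W :: "real^'p^'m"
  assumes "inj ((*v) W)"
  shows "least_squares W (W *v b + c *\<^sub>R z) = b + c *\<^sub>R least_squares W z"
  using least_squares_mult[OF assms, of b]
  by (simp add: least_squares_def matrix_vector_right_distrib matrix_vector_mult_scaleR)

lemma SSR_eq: "SSR W z = z \<bullet> (z - W *v least_squares W z)"
  by (simp del: transpose_matrix_vector add: SSR_def least_squares_def matrix_vector_mult_diff_rdistrib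
      matrix_vector_mul_assoc matrix_mul_assoc)

text \<open>These are the normal equations; the Gram matrix cancels its inverse.\<close>

lemma residual_orthogonal:
  fixes W :: "real^'p^'m"
  assumes "inj ((*v) W)"
  shows "transpose W *v (z - W *v least_squares W z) = 0"
  using matrix_inv_left_right(1)[OF invertible_Gram[OF assms]]
  by (simp del: transpose_matrix_vector add: least_squares_def matrix_vector_mult_diff_distrib matrix_vector_mul_assoc
      matrix_mul_assoc)

lemma inner_mult_eq_transpose: "(W *v b) \<bullet> z = b \<bullet> (transpose W *v z)"
  for W :: "real^'p^'m"
  by (metis dot_lmul_matrix inner_commute transpose_matrix_vector)

text \<open>The fit absorbs \<open>W *v b\<close>, so the residual is \<open>c\<close> times that of
  \<open>z\<close>. It is orthogonal to the range of \<open>W\<close>, hence its product with the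
  response keeps only the \<open>c *\<^sub>R z\<close> term, which gives the second factor
  \<open>c\<close>.\<close>

lemma SSR_affine:
  fixes W :: "real^'p^'m"
  assumes "inj ((*v) W)"
  shows "SSR W (W *v b + c *\<^sub>R z) = c\<^sup>2 * SSR W z"
proof -
  have "W *v b + c *\<^sub>R z - W *v (b + c *\<^sub>R least_squares W z) = c *\<^sub>R (z - W *v least_squares W z)"
    by (simp add: matrix_vector_right_distrib matrix_vector_mult_scaleR algebra_simps)
  thus ?thesis
    by (simp del: transpose_matrix_vector add: SSR_eq least_squares_affine[OF assms] inner_add_left inner_mult_eq_transpose
        residual_orthogonal[OF assms] power2_eq_square)
qed

lemma SSR_eq_norm:
  fixes W :: "real^'p^'m"
  assumes "inj ((*v) W)"
  shows "SSR W z = (norm (z - W *v least_squares W z))\<^sup>2"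
  using residual_orthogonal[OF assms, of z]
  by (simp del: transpose_matrix_vector add: SSR_eq power2_norm_eq_inner inner_diff_left[of z "W *v _"] inner_mult_eq_transpose)

section \<open>Standard Gaussian vectors\<close>

lemma nn_integral_lborel_translation:
  fixes g :: "'a::euclidean_space \<Rightarrow> ennreal"
  assumes "g \<in> borel_measurable borel"
  shows "(\<integral>\<^sup>+x. g (c + x) \<partial>lborel) = (\<integral>\<^sup>+x. g x \<partial>lborel)"
  using assms by (subst (2) lborel_distr_plus[symmetric, of c]) (simp add: nn_integral_distr)

lemma orthogonal_transformation_measurable:
  fixes f :: "'a::euclidean_space \<Rightarrow> 'a"
  assumes "orthogonal_transformation f"
  shows "f \<in> borel_measurable borel"
  using orthogonal_transformation_linear[OF assms]
  by (intro borel_measurable_continuous_onI linear_continuous_on) (simp add: linear_conv_bounded_linear)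

text \<open>Uniqueness of Haar measure by Fubini: with \<open>B\<close> the unit ball, translation invariance and
  \<open>f ` B = B\<close> let one evaluate the double integral of \<open>1\<^sub>B(y) 1\<^sub>A(y + f x)\<close> in either order. The
  library's \<open>measure_orthogonal_image\<close> needs a well-ordered index type.\<close>

lemma distr_lborel_orthogonal:
  fixes f :: "'a::euclidean_space \<Rightarrow> 'a"
  assumes f: "orthogonal_transformation f"
  shows "distr lborel borel f = lborel"
proof (rule measure_eqI)
  fix A :: "'a set"
  assume "A \<in> sets (distr lborel borel f)"
  hence [measurable]: "A \<in> sets borel"
    by simp
  note [measurable] = orthogonal_transformation_measurable[OF f]
  have add: "f (x + y) = f x + f y" for x y
    using f by (simp add: orthogonal_transformation_linear linear_add)
  define B :: "'a set" where "B = ball 0 1"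
  have [measurable]: "B \<in> sets borel"
    by (simp add: B_def)
  have "emeasure lborel B * emeasure (distr lborel borel f) A
      = (\<integral>\<^sup>+y. indicator B y * (\<integral>\<^sup>+x. indicator A (f x) \<partial>lborel) \<partial>lborel)"
    using nn_integral_distr[of f lborel borel "indicator A"] by (simp add: nn_integral_multc)
  also have "\<dots> = (\<integral>\<^sup>+y. indicator B y * (\<integral>\<^sup>+x. indicator A (y + f x) \<partial>lborel) \<partial>lborel)"
  proof (rule nn_integral_cong)
    fix y
    \<comment> \<open>A shift by \<open>y\<close> after \<open>f\<close> is a shift by the preimage
      \<open>z\<close> before \<open>f\<close>, which Lebesgue measure does not see.\<close>
    obtain z where "f z = y"
      using orthogonal_transformation_surj[OF f] by (metis surjD)
    thus "indicator B y * (\<integral>\<^sup>+x. indicator A (f x) \<partial>lborel)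
        = indicator B y * (\<integral>\<^sup>+x. indicator A (y + f x) \<partial>lborel)"
      using nn_integral_lborel_translation[of "\<lambda>x. indicator A (f x)" z] by (simp add: add)
  qed
  also have "\<dots> = (\<integral>\<^sup>+y. \<integral>\<^sup>+x. indicator B y * indicator A (y + f x) \<partial>lborel \<partial>lborel)"
    by (simp add: nn_integral_cmult)
  also have "\<dots> = (\<integral>\<^sup>+x. \<integral>\<^sup>+y. indicator B y * indicator A (y + f x) \<partial>lborel \<partial>lborel)"
    by (rule lborel_pair.Fubini') measurable
  also have "\<dots> = (\<integral>\<^sup>+x. \<integral>\<^sup>+y. indicator B (y - f x) * indicator A y \<partial>lborel \<partial>lborel)"
  proof (rule nn_integral_cong)
    fix x
    show "(\<integral>\<^sup>+y. indicator B y * indicator A (y + f x) \<partial>lborel)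
        = (\<integral>\<^sup>+y. (indicator B (y - f x) * indicator A y :: ennreal) \<partial>lborel)"
      using nn_integral_lborel_translation
        [of "\<lambda>y. indicator B (y - f x) * indicator A y :: ennreal" "f x"]
      by (simp add: add.commute)
  qed
  also have "\<dots> = (\<integral>\<^sup>+y. \<integral>\<^sup>+x. indicator B (y - f x) * indicator A y \<partial>lborel \<partial>lborel)"
    by (rule lborel_pair.Fubini') measurable
  also have "\<dots> = (\<integral>\<^sup>+y. emeasure lborel B * indicator A y \<partial>lborel)"
  proof (rule nn_integral_cong)
    fix y
    obtain z where z: "f z = y"
      using orthogonal_transformation_surj[OF f] by (metis surjD)
    have "norm (f x - y) = norm (z - x)" for x
      using orthogonal_transformation_norm[OF f, of "x - z"]
      by (simp add: linear_diff[OF orthogonal_transformation_linear[OF f]] z norm_minus_commute)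
    hence "indicator B (y - f x) = (indicator (ball z 1) x :: ennreal)" for x
      by (simp add: B_def dist_norm norm_minus_commute indicator_def)
    hence "(\<integral>\<^sup>+x. indicator B (y - f x) * indicator A y \<partial>lborel)
        = emeasure lborel (ball z 1) * indicator A y"
      by (cases "y \<in> A") simp_all
    also have "emeasure lborel (ball z 1) = emeasure lborel B"
      by (simp add: B_def emeasure_ball)
    finally show "(\<integral>\<^sup>+x. indicator B (y - f x) * indicator A y \<partial>lborel)
        = emeasure lborel B * indicator A y" .
  qed
  also have "\<dots> = emeasure lborel B * emeasure lborel A"
    by (simp add: nn_integral_cmult)
  finally have "emeasure lborel B * emeasure (distr lborel borel f) A
      = emeasure lborel B * emeasure lborel A" .
  \<comment> \<open>Positive finite volume of the test set \<open>B\<close> is what permits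
    cancelling it.\<close>
  moreover have "emeasure lborel B \<noteq> 0" "emeasure lborel B \<noteq> \<top>"
    using less_imp_neq[OF unit_ball_vol_pos[of "real DIM('a)"]] by (simp_all add: B_def emeasure_ball)
  ultimately show "emeasure (distr lborel borel f) A = emeasure lborel A"
    by (simp add: ennreal_mult_cancel_left)
qed simp

section \<open>The standard Gaussian law, its density and its rotation invariance\<close>

abbreviation std_normal_measure :: "real measure" where
  "std_normal_measure \<equiv> density lborel std_normal_density"

text \<open>Defined as the image of a product measure so that independence of coordinates is built
  in; rotation invariance is read off the density derived below.\<close>

definition std_gaussian :: "(real^'m) measure" where
  "std_gaussian = distr (\<Pi>\<^sub>M i\<in>UNIV. std_normal_measure) borel (\<lambda>z. \<chi> i. z i)"

lemma space_std_gaussian [simp]: "space std_gaussian = UNIV"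
  by (simp add: std_gaussian_def)

lemma sets_std_gaussian [simp, measurable_cong]: "sets std_gaussian = sets borel"
  by (simp add: std_gaussian_def)

lemma prob_space_std_gaussian: "prob_space (std_gaussian :: (real^'m) measure)"
  unfolding std_gaussian_def
  by (intro prob_space.prob_space_distr prob_space_PiM prob_space_normal_density zero_less_one) measurable

text \<open>Lebesgue measure is determined by its values on boxes, and the preimage of a box is a
  product of intervals. This carries densities from the product measure over to the vector
  type.\<close>

lemma lborel_eq_distr_PiM:
  "(lborel :: (real^'m) measure) = distr (\<Pi>\<^sub>M i\<in>UNIV. lborel) borel (\<lambda>z. \<chi> i. z i)"
proof (rule lborel_eqI)
  fix l u :: "real^'m"
  assume le: "\<And>b. b \<in> Basis \<Longrightarrow> l \<bullet> b \<le> u \<bullet> b"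
  interpret product_sigma_finite "\<lambda>_::'m. lborel :: real measure"
    by standard
  have "l $ i \<le> u $ i" for i
    using le[of "axis i 1"] by (simp add: inner_axis)
  moreover have "(\<lambda>z. \<chi> i. z i) -` box l u \<inter> space (\<Pi>\<^sub>M i\<in>UNIV. lborel)
      = (\<Pi>\<^sub>E i\<in>UNIV. {l $ i<..<u $ i})"
    by (auto simp: mem_box_cart space_PiM PiE_iff)
  ultimately have "emeasure (distr (\<Pi>\<^sub>M i\<in>UNIV. lborel) borel (\<lambda>z. \<chi> i. z i)) (box l u)
      = (\<Prod>i\<in>UNIV. (u - l) $ i)"
    by (simp add: emeasure_distr emeasure_PiM prod_ennreal)
  also have "(\<Prod>i\<in>UNIV. (u - l) $ i) = (\<Prod>b\<in>Basis. (u - l) \<bullet> b)"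
  proof -
    have "(Basis :: (real^'m) set) = range (\<lambda>i. axis i 1)"
      by (auto simp: Basis_vec_def)
    hence "(\<Prod>b\<in>Basis. (u - l) \<bullet> b) = (\<Prod>b\<in>range (\<lambda>i. axis i 1). (u - l) \<bullet> b)"
      by (simp only:)
    also have "\<dots> = (\<Prod>i\<in>UNIV. (u - l) $ i)"
      by (subst prod.reindex) (auto simp: inj_on_def axis_eq_axis inner_axis)
    finally show ?thesis ..
  qed
  finally show "emeasure (distr (\<Pi>\<^sub>M i\<in>UNIV. lborel) borel (\<lambda>z. \<chi> i. z i)) (box l u)
      = (\<Prod>b\<in>Basis. (u - l) \<bullet> b)" .
qed simp

text \<open>A product measure is determined by its values on rectangles. There the indicator splits
  into one factor per coordinate, and so does the integral.\<close>

lemma PiM_density: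
  fixes g :: "'i \<Rightarrow> 'a \<Rightarrow> ennreal"
  assumes "finite I" "\<And>i. sigma_finite_measure (M i)" "\<And>i. sigma_finite_measure (density (M i) (g i))"
    and g: "\<And>i. g i \<in> borel_measurable (M i)"
  shows "(\<Pi>\<^sub>M i\<in>I. density (M i) (g i)) = density (\<Pi>\<^sub>M i\<in>I. M i) (\<lambda>z. \<Prod>i\<in>I. g i (z i))"
proof -
  interpret M: product_sigma_finite M
    using assms by (simp add: product_sigma_finite_def)
  interpret D: product_sigma_finite "\<lambda>i. density (M i) (g i)"
    using assms by (simp add: product_sigma_finite_def)
  note [measurable] = g
  show ?thesis
  proof (rule D.PiM_eqI[symmetric])
    fix A
    assume A: "\<And>i. i \<in> I \<Longrightarrow> A i \<in> sets (density (M i) (g i))"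
    hence [measurable]: "\<And>i. i \<in> I \<Longrightarrow> A i \<in> sets (M i)"
      by simp
    have "emeasure (density (\<Pi>\<^sub>M i\<in>I. M i) (\<lambda>z. \<Prod>i\<in>I. g i (z i))) (Pi\<^sub>E I A)
        = (\<integral>\<^sup>+z. (\<Prod>i\<in>I. g i (z i)) * indicator (Pi\<^sub>E I A) z \<partial>(\<Pi>\<^sub>M i\<in>I. M i))"
      using A assms(1) by (intro emeasure_density) (auto intro!: sets_PiM_I_finite)
    also have "\<dots> = (\<integral>\<^sup>+z. (\<Prod>i\<in>I. g i (z i) * indicator (A i) (z i)) \<partial>(\<Pi>\<^sub>M i\<in>I. M i))"
      using assms(1)
      by (intro nn_integral_cong)
        (auto simp: prod.distrib indicator_def space_PiM PiE_iff prod_zero_iff)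
    also have "\<dots> = (\<Prod>i\<in>I. emeasure (density (M i) (g i)) (A i))"
      using A assms(1) by (subst M.product_nn_integral_prod) (auto simp: emeasure_density intro!: prod.cong)
    finally show "emeasure (density (\<Pi>\<^sub>M i\<in>I. M i) (\<lambda>z. \<Prod>i\<in>I. g i (z i))) (Pi\<^sub>E I A)
        = (\<Prod>i\<in>I. emeasure (density (M i) (g i)) (A i))" .
  qed (use assms in \<open>auto intro!: sets_PiM_cong\<close>)
qed

lemma std_gaussian_eq_density:
  "(std_gaussian :: (real^'m) measure)
    = density lborel (\<lambda>x. ennreal ((1 / sqrt (2 * pi)) ^ CARD('m) * exp (- (norm x)\<^sup>2 / 2)))"
proof -
  have "(\<Pi>\<^sub>M i\<in>(UNIV::'m set). std_normal_measure)
      = density (\<Pi>\<^sub>M i\<in>UNIV. lborel) (\<lambda>z. \<Prod>i\<in>UNIV. ennreal (std_normal_density (z i)))"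
    by (rule PiM_density)
      (auto simp: lborel.sigma_finite_measure_axioms intro!: prob_space_imp_sigma_finite
        prob_space_normal_density)
  \<comment> \<open>Writing the integrand through \<open>(\<chi> i. z i) $ i\<close> makes it a
    function of the vector, the form in which \<open>density_distr\<close> moves it across the image
    measure.\<close>
  hence "(std_gaussian :: (real^'m) measure)
      = distr (density (\<Pi>\<^sub>M i\<in>UNIV. lborel)
          (\<lambda>z. \<Prod>i\<in>UNIV. ennreal (std_normal_density ((\<chi> i. z i) $ i)))) borel (\<lambda>z. \<chi> i. z i)"
    by (simp add: std_gaussian_def)
  also have "\<dots> = density lborel (\<lambda>x. \<Prod>i\<in>UNIV. ennreal (std_normal_density (x $ i)))"
    unfolding lborel_eq_distr_PiM by (rule density_distr[symmetric]; measurable)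
  finally have "(std_gaussian :: (real^'m) measure)
      = density lborel (\<lambda>x. \<Prod>i\<in>UNIV. ennreal (std_normal_density (x $ i)))" .
  also have "(\<lambda>x::real^'m. \<Prod>i\<in>UNIV. ennreal (std_normal_density (x $ i)))
      = (\<lambda>x. ennreal ((1 / sqrt (2 * pi)) ^ CARD('m) * exp (- (norm x)\<^sup>2 / 2)))"
  proof
    fix x :: "real^'m"
    have "(norm x)\<^sup>2 = (\<Sum>i\<in>UNIV. (x $ i)\<^sup>2)"
      by (simp add: norm_vec_def L2_set_def sum_nonneg)
    hence "(\<Prod>i\<in>UNIV. std_normal_density (x $ i))
        = (1 / sqrt (2 * pi)) ^ CARD('m) * exp (- (norm x)\<^sup>2 / 2)"
      by (simp add: std_normal_density_def prod.distrib power_one_over sum_divide_distrib sum_negf prod_dividef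
          flip: exp_sum)
    thus "(\<Prod>i\<in>UNIV. ennreal (std_normal_density (x $ i)))
        = ennreal ((1 / sqrt (2 * pi)) ^ CARD('m) * exp (- (norm x)\<^sup>2 / 2))"
      by (simp add: prod_ennreal normal_density_nonneg)
  qed
  finally show ?thesis .
qed

text \<open>Both ingredients are invariant: Lebesgue measure under \<open>f\<close>, and the density
  because it depends on the norm only.\<close>

lemma distr_std_gaussian_orthogonal:
  fixes f :: "real^'m \<Rightarrow> real^'m"
  assumes f: "orthogonal_transformation f"
  shows "distr std_gaussian borel f = std_gaussian"
proof -
  note [measurable] = orthogonal_transformation_measurable[OF f]
  let ?h = "\<lambda>x::real^'m. ennreal ((1 / sqrt (2 * pi)) ^ CARD('m) * exp (- (norm x)\<^sup>2 / 2))"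
  have "density lborel ?h = density (distr lborel borel f) ?h"
    by (simp add: distr_lborel_orthogonal[OF f])
  also have "\<dots> = distr (density lborel (\<lambda>x. ?h (f x))) borel f"
    by (rule density_distr) measurable
  also have "\<dots> = distr (density lborel ?h) borel f"
    using f by (simp add: orthogonal_transformation)
  finally show ?thesis
    by (simp add: std_gaussian_eq_density)
qed

text \<open>Rotation invariance in the form used below: the coordinates of a standard Gaussian
  vector in any orthonormal basis are again standard Gaussian.\<close>

lemma distr_std_gaussian_orthonormal:
  fixes \<phi> :: "'m::finite \<Rightarrow> real^'m"
  assumes "\<And>i j. \<phi> i \<bullet> \<phi> j = (if i = j then 1 else 0)"
  shows "distr std_gaussian borel (\<lambda>z. \<Sum>i\<in>UNIV. z $ i *\<^sub>R \<phi> i) = std_gaussian"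
proof (rule distr_std_gaussian_orthogonal)
  have "(\<Sum>i\<in>UNIV. v $ i *\<^sub>R \<phi> i) \<bullet> (\<Sum>i\<in>UNIV. w $ i *\<^sub>R \<phi> i) = v \<bullet> w" for v w :: "real^'m"
  proof -
    have "(\<Sum>i\<in>UNIV. v $ i *\<^sub>R \<phi> i) \<bullet> (\<Sum>i\<in>UNIV. w $ i *\<^sub>R \<phi> i) = (\<Sum>i\<in>UNIV. v $ i * w $ i)"
      by (simp add: inner_sum_left inner_sum_right assms if_distrib mult.commute cong: if_cong)
    thus ?thesis
      by (simp add: inner_vec_def)
  qed
  moreover have "linear (\<lambda>z::real^'m. \<Sum>i\<in>UNIV. z $ i *\<^sub>R \<phi> i)"
    by (intro linearI) (simp_all add: scaleR_add_left sum.distrib scaleR_sum_right)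
  ultimately show "orthogonal_transformation (\<lambda>z. \<Sum>i\<in>UNIV. z $ i *\<^sub>R \<phi> i)"
    by (simp add: orthogonal_transformation_def)
qed

section \<open>Independent coordinates and standard Gaussian vectors\<close>

lemma (in prob_space) distr_eq_std_gaussian:
  fixes Z :: "'a \<Rightarrow> real^'m"
  assumes ind: "indep_vars (\<lambda>_. borel) (\<lambda>i \<omega>. Z \<omega> $ i) UNIV"
    and Z: "\<And>i. distributed M lborel (\<lambda>\<omega>. Z \<omega> $ i) std_normal_density"
  shows "distr M borel Z = std_gaussian"
proof -
  have [measurable]: "(\<lambda>\<omega>. Z \<omega> $ i) \<in> borel_measurable M" for i
    using Z[of i] by (simp add: distributed_def)
  have "distr M borel (\<lambda>\<omega>. Z \<omega> $ i) = std_normal_measure" for i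
    using Z[of i] by (simp add: distributed_def cong: distr_cong)
  hence *: "distr M (\<Pi>\<^sub>M i\<in>UNIV. borel) (\<lambda>\<omega>. \<lambda>i\<in>UNIV. Z \<omega> $ i) = (\<Pi>\<^sub>M i\<in>UNIV. std_normal_measure)"
    using ind by (subst (asm) indep_vars_iff_distr_eq_PiM) auto
  have "distr M borel Z = distr M borel (\<lambda>\<omega>. \<chi> i. (\<lambda>i\<in>UNIV. Z \<omega> $ i) i)"
    by simp
  also have "\<dots> = distr (distr M (\<Pi>\<^sub>M i\<in>UNIV. borel) (\<lambda>\<omega>. \<lambda>i\<in>UNIV. Z \<omega> $ i)) borel (\<lambda>z. \<chi> i. z i)"
    by (subst distr_distr) (auto simp: o_def)
  finally show ?thesis
    by (simp add: * std_gaussian_def)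
qed

lemma indep_vars_std_normal_PiM:
  "prob_space.indep_vars (\<Pi>\<^sub>M i\<in>UNIV. std_normal_measure) (\<lambda>_. std_normal_measure)
    (\<lambda>i z. z i) (UNIV :: 'm::finite set)"
proof -
  interpret prob_space "\<Pi>\<^sub>M i\<in>(UNIV::'m set). std_normal_measure"
    by (intro prob_space_PiM prob_space_normal_density zero_less_one)
  show ?thesis
    by (subst indep_vars_iff_distr_eq_PiM)
      (simp_all add: distr_PiM_component[where M = "\<lambda>_::'m. std_normal_measure"] prob_space_normal_density
        restrict_UNIV distr_id2)
qed

text \<open>The source of both independence facts below, fit against residual and \<open>S X\<close>
  against \<open>S e\<close>: each time a rotation makes the two quantities depend on disjoint
  blocks of coordinates.\<close>

lemma distr_std_gaussian_disjoint_coordinates: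
  fixes f :: "real^'m \<Rightarrow> 'b" and g :: "real^'m \<Rightarrow> 'c"
  assumes [measurable]: "f \<in> measurable borel N1" "g \<in> measurable borel N2"
    and "A \<inter> B = {}"
    and f: "\<And>z z'. (\<And>i. i \<in> A \<Longrightarrow> z $ i = z' $ i) \<Longrightarrow> f z = f z'"
    and g: "\<And>z z'. (\<And>i. i \<in> B \<Longrightarrow> z $ i = z' $ i) \<Longrightarrow> g z = g z'"
  shows "distr std_gaussian (N1 \<Otimes>\<^sub>M N2) (\<lambda>z. (f z, g z))
    = distr std_gaussian N1 f \<Otimes>\<^sub>M distr std_gaussian N2 g"
proof -
  let ?N = "\<lambda>_::'m. std_normal_measure"
  let ?P = "\<Pi>\<^sub>M i\<in>UNIV. ?N i"
  let ?r = "\<lambda>C (z::'m \<Rightarrow> real). restrict z C"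
  \<comment> \<open>\<open>e C\<close> pads a family on \<open>C\<close> with zeros. Since
    \<open>f\<close> sees only the coordinates in \<open>A\<close>, it factors through the
    restriction to \<open>A\<close>; likewise \<open>g\<close> through the restriction to
    \<open>B\<close>.\<close>
  define e :: "'m set \<Rightarrow> ('m \<Rightarrow> real) \<Rightarrow> real^'m" where
    "e C z = (\<chi> i. if i \<in> C then z i else 0)" for C z
  have [measurable]: "e C \<in> borel_measurable (Pi\<^sub>M C ?N)" for C
  proof -
    have "(\<lambda>z. if i \<in> C then z i else 0) \<in> borel_measurable (Pi\<^sub>M C ?N)" for i
      by (cases "i \<in> C") auto
    thus ?thesis
      unfolding e_def by measurable
  qed
  interpret P: prob_space ?P
    by (intro prob_space_PiM prob_space_normal_density zero_less_one)
  have fe: "f (\<chi> i. z i) = f (e A (?r A z))" for z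
    by (rule f) (simp add: e_def)
  have ge: "g (\<chi> i. z i) = g (e B (?r B z))" for z
    by (rule g) (simp add: e_def)
  have "P.indep_var (Pi\<^sub>M A ?N) (?r A) (Pi\<^sub>M B ?N) (?r B)"
    using P.indep_var_restrict[OF indep_vars_std_normal_PiM \<open>A \<inter> B = {}\<close>] by simp
  hence joint: "distr ?P (Pi\<^sub>M A ?N \<Otimes>\<^sub>M Pi\<^sub>M B ?N) (\<lambda>z. (?r A z, ?r B z))
      = distr ?P (Pi\<^sub>M A ?N) (?r A) \<Otimes>\<^sub>M distr ?P (Pi\<^sub>M B ?N) (?r B)"
    by (simp add: P.indep_var_distribution_eq)
  have F: "distr std_gaussian N1 f = distr (distr ?P (Pi\<^sub>M A ?N) (?r A)) N1 (\<lambda>z. f (e A z))"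
    by (simp add: std_gaussian_def distr_distr o_def fe)
  have G: "distr std_gaussian N2 g = distr (distr ?P (Pi\<^sub>M B ?N) (?r B)) N2 (\<lambda>z. g (e B z))"
    by (simp add: std_gaussian_def distr_distr o_def ge)
  have "sigma_finite_measure (distr std_gaussian N2 g)"
    by (intro prob_space_imp_sigma_finite prob_space.prob_space_distr prob_space_std_gaussian) simp
  hence "distr std_gaussian N1 f \<Otimes>\<^sub>M distr std_gaussian N2 g
      = distr (distr ?P (Pi\<^sub>M A ?N) (?r A) \<Otimes>\<^sub>M distr ?P (Pi\<^sub>M B ?N) (?r B)) (N1 \<Otimes>\<^sub>M N2)
          (\<lambda>(x, y). (f (e A x), g (e B y)))"
    unfolding F G by (intro pair_measure_distr) (auto simp: G)
  also have "\<dots> = distr ?P (N1 \<Otimes>\<^sub>M N2) (\<lambda>z. (f (\<chi> i. z i), g (\<chi> i. z i)))"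
    unfolding joint[symmetric] by (simp add: distr_distr o_def fe ge)
  also have "\<dots> = distr std_gaussian (N1 \<Otimes>\<^sub>M N2) (\<lambda>z. (f z, g z))"
    by (simp add: std_gaussian_def distr_distr o_def)
  finally show ?thesis ..
qed

section \<open>Almost sure full rank\<close>

lemma matrix_add_rdistrib: "(A + B) ** C = A ** C + B ** C"
  by (vector matrix_matrix_mult_def sum.distrib distrib_right)

text \<open>Translating \<open>N\<close> by multiples of \<open>v\<close> and averaging over the
  unit interval of shifts leaves its measure unchanged. After exchanging the integrals, the inner
  one runs over a countable set of shifts and vanishes.\<close>

lemma null_sets_lborel_of_countable_lines:
  fixes N :: "'a::euclidean_space set"
  assumes [measurable]: "N \<in> sets borel" and N: "\<And>x. countable {t. x + t *\<^sub>R v \<in> N}"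
  shows "N \<in> null_sets lborel"
proof -
  have "emeasure lborel N = (\<integral>\<^sup>+t. indicator {0..1::real} t * (\<integral>\<^sup>+x. indicator N x \<partial>lborel) \<partial>lborel)"
    by (simp add: nn_integral_multc)
  also have "\<dots> = (\<integral>\<^sup>+t. (\<integral>\<^sup>+x. indicator {0..1::real} t * indicator N (x + t *\<^sub>R v) \<partial>lborel) \<partial>lborel)"
  proof (rule nn_integral_cong)
    fix t :: real
    show "indicator {0..1} t * (\<integral>\<^sup>+x. indicator N x \<partial>lborel)
        = (\<integral>\<^sup>+x. indicator {0..1} t * indicator N (x + t *\<^sub>R v) \<partial>lborel)"
      using nn_integral_lborel_translation[of "indicator N" "t *\<^sub>R v"]
      by (simp add: nn_integral_cmult add.commute)
  qed
  also have "\<dots> = (\<integral>\<^sup>+x. (\<integral>\<^sup>+t. indicator {0..1::real} t * indicator N (x + t *\<^sub>R v) \<partial>lborel) \<partial>lborel)"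
    by (rule lborel_pair.Fubini') measurable
  also have "\<dots> = (\<integral>\<^sup>+x. 0 \<partial>(lborel :: 'a measure))"
  proof (rule nn_integral_cong)
    fix x :: 'a
    have "AE t in lborel. x + t *\<^sub>R v \<notin> N"
      using countable_imp_null_set_lborel[OF N[of x]] by (rule AE_not_in[THEN AE_mp]) simp
    hence "(\<integral>\<^sup>+t. indicator {0..1::real} t * indicator N (x + t *\<^sub>R v) \<partial>lborel)
        = (\<integral>\<^sup>+t. 0 \<partial>(lborel :: real measure))"
      by (intro nn_integral_cong_AE) (auto elim!: eventually_mono)
    thus "(\<integral>\<^sup>+t. indicator {0..1::real} t * indicator N (x + t *\<^sub>R v) \<partial>lborel) = 0"
      by simp
  qed
  finally show ?thesis
    by (simp add: null_sets_def)
qed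

lemma finite_singular_shifts:
  fixes A :: "real^'n^'n"
  shows "finite {t. det (A + t *\<^sub>R mat 1) = 0}"
proof -
  \<comment> \<open>The reversed polynomial \<open>det (s *\<^sub>R A + mat 1)\<close> is evidently
    nonzero, having value 1 at 0. Nonzero singular shifts are reciprocals of its roots; the shift 0
    has no reciprocal and is added by hand.\<close>
  define q :: "real poly" where
    "q = (\<Sum>p\<in>{p. p permutes UNIV}. of_int (sign p) * (\<Prod>i\<in>UNIV. [:mat 1 $ i $ p i, A $ i $ p i:]))"
  have q: "poly q s = det (s *\<^sub>R A + mat 1)" for s
    by (simp add: q_def det_def poly_sum poly_prod add.commute)
  have "poly q 0 = 1"
    by (simp add: q)
  hence "finite {s. poly q s = 0}"
    by (intro poly_roots_finite) auto
  hence "finite (insert 0 ((\<lambda>s. 1 / s) ` {s. poly q s = 0}))"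
    by simp
  moreover have "{t. det (A + t *\<^sub>R mat 1) = 0} \<subseteq> insert 0 ((\<lambda>s. 1 / s) ` {s. poly q s = 0})"
  proof
    fix t
    assume t: "t \<in> {t. det (A + t *\<^sub>R mat 1) = 0}"
    have "t \<in> (\<lambda>s. 1 / s) ` {s. poly q s = 0}" if "t \<noteq> 0"
    proof
      have "A + t *\<^sub>R mat 1 = t *\<^sub>R ((1 / t) *\<^sub>R A + mat 1)"
        using that by (simp add: scaleR_add_right)
      hence "det (t *\<^sub>R ((1 / t) *\<^sub>R A + mat 1)) = 0"
        using t by simp
      hence "det ((1 / t) *\<^sub>R A + mat 1) = 0"
        using that scalar_invertible invertible_det_nz by metis
      thus "1 / t \<in> {s. poly q s = 0}"
        by (simp add: q)
    qed simp
    thus "t \<in> insert 0 ((\<lambda>s. 1 / s) ` {s. poly q s = 0})"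
      by auto
  qed
  ultimately show ?thesis
    by (rule finite_subset[rotated])
qed

text \<open>Perturb \<open>s\<close> along a fixed matrix \<open>S\<^sub>0\<close> with \<open>E\<^sup>T S\<^sub>0 X = 1\<close>: then \<open>(s + t S\<^sub>0) X\<close> is
  injective unless \<open>E\<^sup>T s X + t\<close> is singular, hence for all but finitely many \<open>t\<close>.\<close>

lemma null_sets_rank_deficient:
  fixes X :: "real^'p^'n"
  assumes X: "inj ((*v) X)" and kp: "CARD('p) \<le> CARD('k)"
  shows "{s :: real^('k\<times>'n). \<not> inj ((*v) ((\<chi> i j. s $ (i, j)) ** X :: real^'p^'k))} \<in> null_sets lborel"
    (is "?N \<in> _")
proof -
  obtain L where L: "L ** X = mat 1"
    using X matrix_left_invertible_injective by blast
  obtain \<iota> :: "'p \<Rightarrow> 'k" where \<iota>: "inj \<iota>"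
    using kp by (metis card_le_inj finite top_greatest image_subset_iff inj_on_def)
  \<comment> \<open>The columns of \<open>E\<close> are distinct coordinate vectors, hence
    orthonormal; the injection \<open>\<iota>\<close> exists because there are at least as many rows
    as columns.\<close>
  define E :: "real^'p^'k" where "E = (\<chi> i j. if i = \<iota> j then 1 else 0)"
  have "(\<Sum>k\<in>UNIV. E $ k $ i * E $ k $ j) = (\<Sum>k\<in>UNIV. if k = \<iota> i then (if i = j then 1 else 0) else 0)"
    for i j
    using \<iota> by (intro sum.cong) (auto simp: E_def inj_eq)
  hence E: "transpose E ** E = mat 1"
    by (simp add: transpose_def matrix_matrix_mult_def mat_def vec_eq_iff)
  define m :: "real^('k\<times>'n) \<Rightarrow> real^'n^'k" where "m s = (\<chi> i j. s $ (i, j))" for s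
  \<comment> \<open>The flattened matrix \<open>E ** L\<close> is the \<open>S\<^sub>0\<close>
    announced above: \<open>L\<close> cancels \<open>X\<close> and the transpose of \<open>E\<close>
    cancels \<open>E\<close>.\<close>
  define v :: "real^('k\<times>'n)" where "v = (\<chi> ij. (E ** L) $ fst ij $ snd ij)"
  have m: "m (s + t *\<^sub>R v) = m s + t *\<^sub>R (E ** L)" for s t
    by (simp add: m_def v_def vec_eq_iff)
  show ?thesis
  proof (rule null_sets_lborel_of_countable_lines[where v = v])
    have [measurable]: "m \<in> borel_measurable borel"
      unfolding m_def by measurable
    have "?N = {s \<in> space borel. det (transpose (m s ** X) ** (m s ** X)) = 0}"
      by (simp add: inj_iff_det_Gram m_def)
    also have "\<dots> \<in> sets borel"
      by measurable
    finally show "?N \<in> sets borel" .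
  next
    fix s :: "real^('k\<times>'n)"
    have "det (transpose E ** m s ** X + t *\<^sub>R mat 1) = 0" if "\<not> inj ((*v) (m (s + t *\<^sub>R v) ** X))" for t
    proof (rule ccontr)
      assume "det (transpose E ** m s ** X + t *\<^sub>R mat 1) \<noteq> 0"
      moreover have "transpose E ** m s ** X + t *\<^sub>R mat 1 = transpose E ** (m (s + t *\<^sub>R v) ** X)"
      proof -
        have "transpose E ** ((E ** L) ** X) = mat 1"
          by (metis E L matrix_mul_assoc matrix_mul_rid)
        thus ?thesis
          by (simp add: m matrix_add_ldistrib matrix_add_rdistrib matrix_mul_assoc matrix_scalar_ac
              flip: scalar_matrix_assoc)
      qed
      ultimately obtain B where "B ** (transpose E ** (m (s + t *\<^sub>R v) ** X)) = mat 1"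
        by (metis invertible_def invertible_det_nz)
      hence "inj ((*v) (m (s + t *\<^sub>R v) ** X))"
        by (metis matrix_left_invertible_injective matrix_mul_assoc)
      with that show False ..
    qed
    hence "{t. s + t *\<^sub>R v \<in> ?N} \<subseteq> {t. det (transpose E ** m s ** X + t *\<^sub>R mat 1) = 0}"
      by (auto simp: m_def)
    thus "countable {t. s + t *\<^sub>R v \<in> ?N}"
      by (rule countable_subset[OF _ countable_finite[OF finite_singular_shifts]])
  qed
qed

text \<open>A law with a Lebesgue density inherits the null sets of Lebesgue measure.\<close>

lemma AE_std_gaussian_full_rank:
  fixes X :: "real^'p^'n"
  assumes "inj ((*v) X)" "CARD('p) \<le> CARD('k)"
  shows "AE s in (std_gaussian :: (real^('k\<times>'n)) measure).
    inj ((*v) ((\<chi> i j. s $ (i, j)) ** X :: real^'p^'k))"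
  using AE_not_in[OF null_sets_rank_deficient[OF assms]]
  unfolding std_gaussian_eq_density
  by (subst AE_density) (auto elim!: eventually_mono)

section \<open>Regression of a Gaussian vector\<close>

lemma distr_std_gaussian_sum_squares:
  fixes C :: "'m::finite set"
  shows "distr std_gaussian borel (\<lambda>z. \<Sum>i\<in>C. (z $ i)\<^sup>2) = chi_squared (card C)"
proof -
  let ?P = "\<Pi>\<^sub>M i\<in>(UNIV::'m set). std_normal_measure"
  let ?I = "{..<card C}"
  obtain h where h: "bij_betw h ?I C"
    using ex_bij_betw_nat_finite[of C] by (auto simp: atLeast0LessThan)
  have "chi_squared (card C) = distr (distr ?P (\<Pi>\<^sub>M i\<in>?I. std_normal_measure) (\<lambda>z. \<lambda>n\<in>?I. z (h n)))
      borel (\<lambda>z. \<Sum>i<card C. (z i)\<^sup>2)"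
    unfolding chi_squared_def using h
    by (subst distr_PiM_reindex) (auto simp: prob_space_normal_density bij_betw_def)
  also have "\<dots> = distr ?P borel (\<lambda>z. \<Sum>i<card C. (z (h i))\<^sup>2)"
    by (subst distr_distr) (auto simp: o_def)
  also have "(\<lambda>z::'m \<Rightarrow> real. \<Sum>i<card C. (z (h i))\<^sup>2) = (\<lambda>z. \<Sum>i\<in>C. (z i)\<^sup>2)"
    by (rule ext) (rule sum.reindex_bij_betw[OF h])
  also have "distr ?P borel (\<lambda>z. \<Sum>i\<in>C. (z i)\<^sup>2) = distr std_gaussian borel (\<lambda>z. \<Sum>i\<in>C. (z $ i)\<^sup>2)"
    unfolding std_gaussian_def by (subst distr_distr) (auto simp: o_def)
  finally show ?thesis ..
qed

text \<open>Joins orthonormal bases of the range of \<open>w\<close> and of its orthogonal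
  complement; \<open>C\<close> collects the indices of the latter.\<close>

lemma orthonormal_basis_adapted_to_range:
  fixes w :: "real^'p^'k"
  assumes w: "inj ((*v) w)"
  obtains \<phi> :: "'k::finite \<Rightarrow> real^'k" and C where
    "\<And>i j. \<phi> i \<bullet> \<phi> j = (if i = j then 1 else 0)" "card C = CARD('k) - CARD('p)"
    "\<And>i. i \<in> C \<Longrightarrow> transpose w *v \<phi> i = 0" "\<And>i. i \<notin> C \<Longrightarrow> \<phi> i \<in> range ((*v) w)"
proof -
  define V where "V = range ((*v) w)"
  define V' where "V' = {y \<in> UNIV. \<forall>x\<in>V. orthogonal x y}"
  have V: "subspace V"
    unfolding V_def by (intro linear_subspace_image) auto
  have V': "subspace V'"
    using subspace_orthogonal_to_vectors[of V] by (simp add: V'_def)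
  have dim: "dim V = CARD('p)"
    using dim_image_eq[of "(*v) w" UNIV] w by (simp add: V_def)
  hence dim': "dim V' = CARD('k) - CARD('p)" and "CARD('p) \<le> CARD('k)"
    using dim_subspace_orthogonal_to_vectors[of V UNIV] V by (auto simp: V'_def)
  obtain B1 where B1: "B1 \<subseteq> V" "pairwise orthogonal B1" "\<And>x. x \<in> B1 \<Longrightarrow> norm x = 1"
      "card B1 = CARD('p)" "independent B1"
    using orthonormal_basis_subspace[OF V] dim by metis
  obtain B2 where B2: "B2 \<subseteq> V'" "pairwise orthogonal B2" "\<And>x. x \<in> B2 \<Longrightarrow> norm x = 1"
      "card B2 = CARD('k) - CARD('p)" "independent B2"
    using orthonormal_basis_subspace[OF V'] dim' by metis
  have orth: "orthogonal x y" if "x \<in> B1" "y \<in> B2" for x y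
    using that B1(1) B2(1) by (auto simp: V'_def)
  have disj: "B1 \<inter> B2 = {}"
    using orth B1(3) by (fastforce simp: orthogonal_self)
  have fin: "finite B1" "finite B2"
    using B1(5) B2(5) independent_imp_finite by auto
  have "card (B1 \<union> B2) = CARD('k)"
    using card_Un_disjoint[OF fin disj] B1(4) B2(4) \<open>CARD('p) \<le> CARD('k)\<close> by simp
  then obtain \<phi> :: "'k \<Rightarrow> real^'k" where \<phi>: "bij_betw \<phi> UNIV (B1 \<union> B2)"
    using finite_same_card_bij[of "UNIV :: 'k set" "B1 \<union> B2"] fin by auto
  hence in_B: "\<phi> i \<in> B1 \<union> B2" and inj: "\<phi> i = \<phi> j \<longleftrightarrow> i = j" for i j
    by (auto simp: bij_betw_def inj_eq)
  show ?thesis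
  proof (rule that)
    fix i j
    show "\<phi> i \<bullet> \<phi> j = (if i = j then 1 else 0)"
    proof (cases "i = j")
      case True
      thus ?thesis
        using in_B[of i] B1(3) B2(3) by (auto simp: norm_eq_1)
    next
      case False
      hence "\<phi> i \<noteq> \<phi> j"
        by (simp add: inj)
      hence "orthogonal (\<phi> i) (\<phi> j)"
        using in_B[of i] in_B[of j] B1(2) B2(2) orth[of "\<phi> i" "\<phi> j"] orth[of "\<phi> j" "\<phi> i"]
        by (auto simp: pairwise_def orthogonal_commute)
      with False show ?thesis
        by (simp add: orthogonal_def)
    qed
  next
    have "card (\<phi> -` B2) = card B2"
      using \<phi> by (intro card_vimage_inj) (auto simp: bij_betw_def)
    thus "card (\<phi> -` B2) = CARD('k) - CARD('p)"
      by (simp add: B2(4))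
  next
    fix i
    assume "i \<in> \<phi> -` B2"
    hence "(w *v b) \<bullet> \<phi> i = 0" for b
      using B2(1) by (auto simp: V'_def V_def orthogonal_def)
    \<comment> \<open>The choice \<open>b = transpose w *v \<phi> i\<close> turns orthogonality to
      the range into a vanishing squared norm.\<close>
    hence "(transpose w *v \<phi> i) \<bullet> (transpose w *v \<phi> i) = 0"
      by (metis inner_mult_eq_transpose)
    thus "transpose w *v \<phi> i = 0"
      by simp
  next
    fix i
    assume "i \<notin> \<phi> -` B2"
    thus "\<phi> i \<in> range ((*v) w)"
      using in_B[of i] B1(1) by (auto simp: V_def)
  qed
qed

lemma least_squares_add_residual:
  assumes "transpose w *v b = 0"
  shows "least_squares w (a + b) = least_squares w a"
  using assms by (simp del: transpose_matrix_vector add: least_squares_def matrix_vector_right_distrib)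

lemma SSR_of_residual:
  assumes "transpose w *v b = 0"
  shows "SSR w b = b \<bullet> b"
  using assms by (simp del: transpose_matrix_vector add: SSR_eq least_squares_def)

text \<open>In the adapted basis the estimator uses the coordinates outside \<open>C\<close> and the
  residual sum of squares those in \<open>C\<close>. The law of the estimator may stay implicit;
  what matters is that the second factor is free of \<open>w\<close>.\<close>

lemma distr_std_gaussian_least_squares_SSR:
  fixes w :: "real^'p^'k"
  assumes w: "inj ((*v) w)"
  shows "distr std_gaussian (borel \<Otimes>\<^sub>M borel) (\<lambda>z. (least_squares w z, SSR w z))
    = distr std_gaussian borel (least_squares w) \<Otimes>\<^sub>M chi_squared (CARD('k) - CARD('p))"
proof -
  obtain \<phi> :: "'k \<Rightarrow> real^'k" and C where
    \<phi>: "\<And>i j. \<phi> i \<bullet> \<phi> j = (if i = j then 1 else 0)" and C: "card C = CARD('k) - CARD('p)"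
    and \<phi>_C: "\<And>i. i \<in> C \<Longrightarrow> transpose w *v \<phi> i = 0"
    and \<phi>_notin_C: "\<And>i. i \<notin> C \<Longrightarrow> \<phi> i \<in> range ((*v) w)"
    using orthonormal_basis_adapted_to_range[OF w] by metis
  \<comment> \<open>\<open>a\<close> is the part in the range of \<open>w\<close> and
    \<open>b\<close> the residual part of the rotated vector \<open>f u\<close>.\<close>
  define a where "a u = (\<Sum>i\<in>-C. u $ i *\<^sub>R \<phi> i)" for u :: "real^'k"
  define b where "b u = (\<Sum>i\<in>C. u $ i *\<^sub>R \<phi> i)" for u :: "real^'k"
  define f where "f u = (\<Sum>i\<in>UNIV. u $ i *\<^sub>R \<phi> i)" for u :: "real^'k"
  have [measurable]: "f \<in> borel_measurable borel" "a \<in> borel_measurable borel"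
    unfolding f_def a_def by measurable
  have f: "f u = a u + b u" for u
    using sum.union_disjoint[of "-C" C "\<lambda>i. u $ i *\<^sub>R \<phi> i"] by (simp add: f_def a_def b_def Compl_partition2)
  have b: "transpose w *v b u = 0" for u
    by (simp del: transpose_matrix_vector add: b_def linear_sum[OF matrix_vector_mul_linear] matrix_vector_mult_scaleR \<phi>_C)
  have "a u \<in> range ((*v) w)" for u
    unfolding a_def using \<phi>_notin_C
    by (intro subspace_sum subspace_scale) (auto intro!: linear_subspace_image)
  hence "\<exists>c. a u = w *v c" for u
    by auto
  hence "SSR w (f u) = b u \<bullet> b u" for u
    using SSR_affine[OF w, of _ 1 "b u"] by (metis SSR_of_residual[OF b] f mult_1 one_power2 scaleR_one)
  moreover have "b u \<bullet> b u = (\<Sum>i\<in>C. (u $ i)\<^sup>2)" for u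
    by (simp add: b_def inner_sum_left inner_sum_right \<phi> power2_eq_square if_distrib cong: if_cong)
  ultimately have SSR_f: "SSR w (f u) = (\<Sum>i\<in>C. (u $ i)\<^sup>2)" for u
    by simp
  have LS_f: "least_squares w (f u) = least_squares w (a u)" for u
    by (simp add: f least_squares_add_residual[OF b])
  have f_std: "distr std_gaussian borel f = std_gaussian"
    using distr_std_gaussian_orthonormal[OF \<phi>] by (simp add: f_def[abs_def])
  have "distr std_gaussian (borel \<Otimes>\<^sub>M borel) (\<lambda>z. (least_squares w z, SSR w z))
      = distr std_gaussian (borel \<Otimes>\<^sub>M borel) (\<lambda>u. (least_squares w (a u), \<Sum>i\<in>C. (u $ i)\<^sup>2))"
    by (subst f_std[symmetric], subst distr_distr) (auto simp: o_def SSR_f LS_f)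
  also have "\<dots> = distr std_gaussian borel (\<lambda>u. least_squares w (a u))
      \<Otimes>\<^sub>M distr std_gaussian borel (\<lambda>u. \<Sum>i\<in>C. (u $ i)\<^sup>2)"
    by (rule distr_std_gaussian_disjoint_coordinates[where A = "-C" and B = C])
      (auto simp: a_def intro!: arg_cong[where f = "least_squares w"] sum.cong)
  \<comment> \<open>Rotating back removes the auxiliary basis from the first marginal.\<close>
  also have "distr std_gaussian borel (\<lambda>u. least_squares w (a u)) = distr std_gaussian borel (least_squares w)"
    by (subst (2) f_std[symmetric], subst distr_distr) (auto simp: o_def LS_f)
  finally show ?thesis
    by (simp add: distr_std_gaussian_sum_squares C)
qed

section \<open>Splitting off the noise, and regression on a random design\<close>

lemma prob_space_chi_squared: "prob_space (chi_squared m)"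
  unfolding chi_squared_def
  by (intro prob_space.prob_space_distr prob_space_PiM prob_space_normal_density zero_less_one) measurable

lemma sets_chi_squared [simp, measurable_cong]: "sets (chi_squared m) = sets borel"
  by (simp add: chi_squared_def)

lemma distr_std_gaussian_subvector:
  fixes h :: "'k::finite \<Rightarrow> 'm::finite"
  assumes "inj h"
  shows "distr std_gaussian borel (\<lambda>z. \<chi> i. z $ h i) = std_gaussian"
proof -
  let ?P = "\<Pi>\<^sub>M i\<in>(UNIV::'m set). std_normal_measure"
  have "(std_gaussian :: (real^'k) measure)
      = distr (distr ?P (\<Pi>\<^sub>M i\<in>UNIV. std_normal_measure) (\<lambda>z. \<lambda>i\<in>UNIV. z (h i))) borel (\<lambda>z. \<chi> i. z i)"
    unfolding std_gaussian_def using assms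
    by (subst distr_PiM_reindex) (auto simp: prob_space_normal_density)
  also have "\<dots> = distr ?P borel (\<lambda>z. \<chi> i. z (h i))"
  proof (subst distr_distr)
    show "(\<lambda>z. \<lambda>i\<in>UNIV. z (h i)) \<in> measurable ?P (\<Pi>\<^sub>M i\<in>UNIV. std_normal_measure)"
      by measurable
  qed (auto simp: o_def restrict_UNIV)
  also have "\<dots> = distr std_gaussian borel (\<lambda>z. \<chi> i. z $ h i)"
    unfolding std_gaussian_def by (subst distr_distr) (auto simp: o_def)
  finally show ?thesis ..
qed

text \<open>Rotating the rows so that the unit vector \<open>e\<close> becomes a coordinate axis \<open>j\<^sub>0\<close> turns \<open>s e\<close> into
  column \<open>j\<^sub>0\<close>, while \<open>s X\<close> depends on the other columns only.\<close>

lemma distr_std_gaussian_mult_orthogonal: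
  fixes X :: "real^'p^'n" and e :: "real^'n"
  assumes e: "norm e = 1" "transpose X *v e = 0"
  defines "m \<equiv> \<lambda>s :: real^('k::finite\<times>'n). \<chi> i j. s $ (i, j)"
  shows "distr std_gaussian (borel \<Otimes>\<^sub>M borel) (\<lambda>s. (m s ** X, m s *v e))
    = distr std_gaussian borel (\<lambda>s. m s ** X) \<Otimes>\<^sub>M std_gaussian"
proof -
  \<comment> \<open>Any column index serves as the axis that \<open>Q\<close> carries to
    \<open>e\<close>.\<close>
  fix j\<^sub>0 :: 'n
  obtain Q where Q: "orthogonal_matrix Q" and Q_axis: "Q *v axis j\<^sub>0 1 = e"
    using orthogonal_matrix_exists_basis[OF e(1)] .
  \<comment> \<open>Entry \<open>(i, j)\<close> contributes column \<open>j\<close> of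
    \<open>Q\<close> placed in row \<open>i\<close>, so that the change of basis \<open>f\<close>
    multiplies the matrix by the transpose of \<open>Q\<close> on the right.\<close>
  define \<phi> :: "'k \<times> 'n \<Rightarrow> real^('k\<times>'n)" where
    "\<phi> ij = (\<chi> il. if fst il = fst ij then Q $ snd il $ snd ij else 0)" for ij
  have "(\<Sum>l\<in>UNIV. Q $ l $ j * Q $ l $ j') = (transpose Q ** Q) $ j $ j'" for j j'
    by (simp add: transpose_def matrix_matrix_mult_def)
  hence QQ: "(\<Sum>l\<in>UNIV. Q $ l $ j * Q $ l $ j') = (if j = j' then 1 else 0)" for j j'
    using Q by (simp add: orthogonal_matrix mat_def)
  have \<phi>: "\<phi> a \<bullet> \<phi> b = (if a = b then 1 else 0)" for a b
  proof -
    have "\<phi> a \<bullet> \<phi> b = (\<Sum>i\<in>UNIV. \<Sum>l\<in>UNIV. \<phi> a $ (i, l) * \<phi> b $ (i, l))"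
      by (simp add: inner_vec_def sum.cartesian_product)
    also have "\<dots> = (\<Sum>i\<in>UNIV. if i = fst a then (if fst a = fst b
        then \<Sum>l\<in>UNIV. Q $ l $ snd a * Q $ l $ snd b else 0) else 0)"
      by (intro sum.cong) (auto simp: \<phi>_def)
    also have "\<dots> = (if a = b then 1 else 0)"
      by (simp add: QQ prod_eq_iff)
    finally show ?thesis .
  qed
  define f where "f T = (\<Sum>ij\<in>UNIV. T $ ij *\<^sub>R \<phi> ij)" for T :: "real^('k\<times>'n)"
  have f_std: "distr std_gaussian borel f = std_gaussian"
    using distr_std_gaussian_orthonormal[OF \<phi>] by (simp add: f_def[abs_def])
  have [measurable]: "f \<in> borel_measurable borel" "m \<in> borel_measurable borel"
    unfolding f_def m_def by measurable
  have m_f: "m (f T) = m T ** transpose Q" for T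
  proof -
    have "f T $ (i, l) = (\<Sum>a\<in>UNIV. \<Sum>j\<in>UNIV. T $ (a, j) * \<phi> (a, j) $ (i, l))" for i l
      by (simp add: f_def sum.cartesian_product)
    also have "\<dots> i l = (\<Sum>a\<in>UNIV. if a = i then \<Sum>j\<in>UNIV. T $ (i, j) * Q $ l $ j else 0)" for i l
      by (intro sum.cong) (auto simp: \<phi>_def)
    finally show ?thesis
      by (simp add: m_def vec_eq_iff matrix_matrix_mult_def transpose_def)
  qed
  have "transpose Q *v e = axis j\<^sub>0 1"
    using Q by (metis Q_axis matrix_vector_mul_assoc matrix_vector_mul_lid orthogonal_matrix)
  hence "m (f T) *v e = m T *v axis j\<^sub>0 1" for T
    by (metis m_f matrix_vector_mul_assoc)
  hence Z: "m (f T) *v e = (\<chi> i. T $ (i, j\<^sub>0))" for T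
    by (simp add: matrix_vector_mult_basis column_def) (simp add: m_def)
  \<comment> \<open>Column \<open>j\<^sub>0\<close> of \<open>Q\<close> is \<open>e\<close>, which
    is orthogonal to the columns of \<open>X\<close>. Hence \<open>m (f T) ** X\<close> does not
    involve column \<open>j\<^sub>0\<close> of \<open>T\<close>.\<close>
  have "(transpose Q ** X) $ j\<^sub>0 $ q = 0" for q
  proof -
    have "e $ l = Q $ l $ j\<^sub>0" for l
      by (simp add: matrix_vector_mult_basis column_def flip: Q_axis)
    hence "(transpose Q ** X) $ j\<^sub>0 $ q = (transpose X *v e) $ q"
      by (simp del: transpose_matrix_vector add: transpose_def matrix_matrix_mult_def
          matrix_vector_mult_def mult.commute)
    thus ?thesis
      by (simp only: e(2) zero_index)
  qed
  hence W: "m (f T) ** X = (\<chi> i q. \<Sum>j\<in>UNIV - {j\<^sub>0}. T $ (i, j) * (transpose Q ** X) $ j $ q)" for T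
    by (subst m_f, subst matrix_mul_assoc[symmetric])
      (simp add: m_def matrix_matrix_mult_def[of "vec_lambda _"] sum.remove[of UNIV j\<^sub>0])
  have "distr std_gaussian (borel \<Otimes>\<^sub>M borel) (\<lambda>s. (m s ** X, m s *v e))
      = distr std_gaussian (borel \<Otimes>\<^sub>M borel) (\<lambda>T. (m (f T) ** X, m (f T) *v e))"
    by (subst f_std[symmetric], subst distr_distr) (auto simp: o_def)
  also have "\<dots> = distr std_gaussian borel (\<lambda>T. m (f T) ** X) \<Otimes>\<^sub>M distr std_gaussian borel (\<lambda>T. m (f T) *v e)"
    by (rule distr_std_gaussian_disjoint_coordinates[where A = "{ij. snd ij \<noteq> j\<^sub>0}" and B = "{ij. snd ij = j\<^sub>0}"])
      (auto simp: W Z)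
  also have "distr std_gaussian borel (\<lambda>T. m (f T) ** X) = distr std_gaussian borel (\<lambda>s. m s ** X)"
    by (subst (2) f_std[symmetric], subst distr_distr) (auto simp: o_def)
  also have "distr std_gaussian borel (\<lambda>T. m (f T) *v e) = std_gaussian"
    unfolding Z by (rule distr_std_gaussian_subvector) (simp add: inj_on_def)
  finally show ?thesis .
qed

text \<open>The conditional law given the design \<open>w\<close> is the one of \<open>distr_std_gaussian_least_squares_SSR\<close>;
  its second factor does not depend on \<open>w\<close>.\<close>

lemma distr_least_squares_SSR_random_design:
  fixes \<mu> :: "(real^'p^'k) measure" and \<beta> :: "real^'p"
  assumes "prob_space \<mu>" and sets_\<mu> [measurable_cong]: "sets \<mu> = sets borel"
    and full_rank: "AE w in \<mu>. inj ((*v) w)" and c: "c \<noteq> 0"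
  defines "L \<equiv> \<lambda>(w, z). least_squares w (w *v \<beta> + c *\<^sub>R z)"
    and "R \<equiv> \<lambda>(w, z). SSR w (w *v \<beta> + c *\<^sub>R z) / c\<^sup>2"
  shows "distr (\<mu> \<Otimes>\<^sub>M std_gaussian) (borel \<Otimes>\<^sub>M borel) (\<lambda>x. (L x, R x))
    = distr (\<mu> \<Otimes>\<^sub>M std_gaussian) borel L \<Otimes>\<^sub>M chi_squared (CARD('k) - CARD('p))"
proof -
  let ?G = "std_gaussian :: (real^'k) measure"
  let ?\<chi> = "chi_squared (CARD('k) - CARD('p))"
  interpret \<mu>: prob_space \<mu> by fact
  interpret G: prob_space ?G by (rule prob_space_std_gaussian)
  interpret pair_prob_space \<mu> ?G ..
  interpret \<chi>: prob_space ?\<chi> by (rule prob_space_chi_squared)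
  have [measurable]: "L \<in> borel_measurable (\<mu> \<Otimes>\<^sub>M ?G)" "R \<in> borel_measurable (\<mu> \<Otimes>\<^sub>M ?G)"
    unfolding L_def R_def by measurable
  have space: "space \<mu> = UNIV"
    using sets_eq_imp_space_eq[OF sets_\<mu>] by simp
  have cond: "emeasure ?G {z. L (w, z) \<in> A \<and> R (w, z) \<in> B} = emeasure ?G {z. L (w, z) \<in> A} * emeasure ?\<chi> B"
    if w: "inj ((*v) w)" and [measurable]: "A \<in> sets borel" "B \<in> sets borel" for w A B
  proof -
    \<comment> \<open>\<open>A'\<close> absorbs the affine map from the estimator of
      \<open>z\<close> to that of the full response.\<close>
    define A' where "A' = {b. \<beta> + c *\<^sub>R b \<in> A}"
    have [measurable]: "A' \<in> sets borel"
      unfolding A'_def by measurable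
    have L: "L (w, z) \<in> A \<longleftrightarrow> least_squares w z \<in> A'" and R: "R (w, z) = SSR w z" for z
      using c by (simp_all add: L_def R_def A'_def least_squares_affine[OF w] SSR_affine[OF w])
    have "emeasure ?G {z. L (w, z) \<in> A \<and> R (w, z) \<in> B}
        = emeasure (distr ?G (borel \<Otimes>\<^sub>M borel) (\<lambda>z. (least_squares w z, SSR w z))) (A' \<times> B)"
      by (subst emeasure_distr) (auto simp: L R vimage_def)
    also have "\<dots> = emeasure (distr ?G borel (least_squares w)) A' * emeasure ?\<chi> B"
      unfolding distr_std_gaussian_least_squares_SSR[OF w] by (subst \<chi>.emeasure_pair_measure_Times) auto
    also have "emeasure (distr ?G borel (least_squares w)) A' = emeasure ?G {z. L (w, z) \<in> A}"
      by (subst emeasure_distr) (auto simp: L vimage_def)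
    finally show ?thesis .
  qed
  show ?thesis
  proof (rule pair_measure_eqI[symmetric])
    show "sigma_finite_measure (distr (\<mu> \<Otimes>\<^sub>M ?G) borel L)"
      by (intro prob_space_imp_sigma_finite prob_space_distr) measurable
    fix A B
    assume "A \<in> sets (distr (\<mu> \<Otimes>\<^sub>M ?G) borel L)" "B \<in> sets ?\<chi>"
    hence [measurable]: "A \<in> sets borel" "B \<in> sets borel"
      by simp_all
    have "emeasure (distr (\<mu> \<Otimes>\<^sub>M ?G) (borel \<Otimes>\<^sub>M borel) (\<lambda>x. (L x, R x))) (A \<times> B)
        = emeasure (\<mu> \<Otimes>\<^sub>M ?G) {x \<in> space (\<mu> \<Otimes>\<^sub>M ?G). L x \<in> A \<and> R x \<in> B}"
      by (subst emeasure_distr) (auto intro!: arg_cong[where f = "emeasure _"])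
    also have "\<dots> = (\<integral>\<^sup>+w. emeasure ?G {z. L (w, z) \<in> A \<and> R (w, z) \<in> B} \<partial>\<mu>)"
    proof (subst G.emeasure_pair_measure_alt)
      show "{x \<in> space (\<mu> \<Otimes>\<^sub>M ?G). L x \<in> A \<and> R x \<in> B} \<in> sets (\<mu> \<Otimes>\<^sub>M ?G)"
        by measurable
    qed (simp add: space space_pair_measure vimage_def)
    \<comment> \<open>The factorisation \<open>cond\<close> requires full rank, which holds for
      almost every \<open>w\<close>.\<close>
    also have "\<dots> = (\<integral>\<^sup>+w. emeasure ?G {z. L (w, z) \<in> A} * emeasure ?\<chi> B \<partial>\<mu>)"
      using full_rank by (intro nn_integral_cong_AE) (auto simp: cond elim!: eventually_mono)
    also have "\<dots> = (\<integral>\<^sup>+w. emeasure ?G {z. L (w, z) \<in> A} \<partial>\<mu>) * emeasure ?\<chi> B"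
    proof (rule nn_integral_multc)
      have "(\<lambda>w. emeasure ?G (Pair w -` {x \<in> space (\<mu> \<Otimes>\<^sub>M ?G). L x \<in> A})) \<in> borel_measurable \<mu>"
        by (rule G.measurable_emeasure_Pair) measurable
      thus "(\<lambda>w. emeasure ?G {z. L (w, z) \<in> A}) \<in> borel_measurable \<mu>"
        by (simp add: space space_pair_measure vimage_def)
    qed
    also have "(\<integral>\<^sup>+w. emeasure ?G {z. L (w, z) \<in> A} \<partial>\<mu>) = emeasure (\<mu> \<Otimes>\<^sub>M ?G) {x \<in> space (\<mu> \<Otimes>\<^sub>M ?G). L x \<in> A}"
    proof (subst G.emeasure_pair_measure_alt)
      show "{x \<in> space (\<mu> \<Otimes>\<^sub>M ?G). L x \<in> A} \<in> sets (\<mu> \<Otimes>\<^sub>M ?G)"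
        by measurable
    qed (simp add: space space_pair_measure vimage_def)
    also have "\<dots> = emeasure (distr (\<mu> \<Otimes>\<^sub>M ?G) borel L) A"
      by (subst emeasure_distr) (auto intro!: arg_cong[where f = "emeasure _"])
    finally show "emeasure (distr (\<mu> \<Otimes>\<^sub>M ?G) borel L) A * emeasure ?\<chi> B
        = emeasure (distr (\<mu> \<Otimes>\<^sub>M ?G) (borel \<Otimes>\<^sub>M borel) (\<lambda>x. (L x, R x))) (A \<times> B)" ..
  qed (auto simp: \<chi>.sigma_finite_measure_axioms intro!: sets_pair_measure_cong)
qed

text \<open>Reads both conclusions off a product law. The map \<open>g\<close> allows the
  independence claim to concern the unscaled residual sum of squares while \<open>K\<close> is the
  law of the scaled one.\<close>

lemma (in prob_space) product_law_imp_indep_rvs: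
  assumes [measurable]: "X \<in> measurable M N1" "Y \<in> measurable M N2" "g \<in> measurable N2 N3"
    and K: "prob_space K" "sets K = sets N2"
    and law: "distr M (N1 \<Otimes>\<^sub>M N2) (\<lambda>\<omega>. (X \<omega>, Y \<omega>)) = distr M N1 X \<Otimes>\<^sub>M K"
  shows "distr M N2 Y = K" "indep_rvs M N1 X N3 (\<lambda>\<omega>. g (Y \<omega>))"
proof -
  interpret K: prob_space K by fact
  have prod: "emeasure M {\<omega> \<in> space M. X \<omega> \<in> A \<and> Y \<omega> \<in> B} = emeasure M {\<omega> \<in> space M. X \<omega> \<in> A} * emeasure K B"
    if [measurable]: "A \<in> sets N1" "B \<in> sets N2" for A B
  proof -
    have "emeasure M {\<omega> \<in> space M. X \<omega> \<in> A \<and> Y \<omega> \<in> B}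
        = emeasure (distr M (N1 \<Otimes>\<^sub>M N2) (\<lambda>\<omega>. (X \<omega>, Y \<omega>))) (A \<times> B)"
      by (subst emeasure_distr) (auto intro!: arg_cong[where f = "emeasure _"])
    also have "\<dots> = emeasure (distr M N1 X) A * emeasure K B"
      unfolding law by (subst K.emeasure_pair_measure_Times) (auto simp: K)
    also have "emeasure (distr M N1 X) A = emeasure M {\<omega> \<in> space M. X \<omega> \<in> A}"
      by (subst emeasure_distr) (auto intro!: arg_cong[where f = "emeasure _"])
    finally show ?thesis .
  qed
  show Y: "distr M N2 Y = K"
  proof (rule measure_eqI)
    fix B
    assume "B \<in> sets (distr M N2 Y)"
    hence [measurable]: "B \<in> sets N2"
      by simp
    \<comment> \<open>Taking the whole space for the first set identifies \<open>K\<close> as the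
      law of \<open>Y\<close>.\<close>
    have "emeasure (distr M N2 Y) B = emeasure M {\<omega> \<in> space M. X \<omega> \<in> space N1 \<and> Y \<omega> \<in> B}"
      using measurable_space[OF assms(1)]
      by (subst emeasure_distr) (auto intro!: arg_cong[where f = "emeasure _"])
    also have "\<dots> = emeasure M {\<omega> \<in> space M. X \<omega> \<in> space N1} * emeasure K B"
      by (rule prod) auto
    also have "{\<omega> \<in> space M. X \<omega> \<in> space N1} = space M"
      using measurable_space[OF assms(1)] by auto
    finally show "emeasure (distr M N2 Y) B = emeasure K B"
      by (simp add: emeasure_space_1)
  qed (simp add: K)
  have indep: "prob (X -` A \<inter> space M \<inter> ((\<lambda>\<omega>. g (Y \<omega>)) -` C \<inter> space M))
      = prob (X -` A \<inter> space M) * prob ((\<lambda>\<omega>. g (Y \<omega>)) -` C \<inter> space M)"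
    if A: "A \<in> sets N1" and C [measurable]: "C \<in> sets N3" for A C
  proof -
    let ?B = "g -` C \<inter> space N2"
    have B: "?B \<in> sets N2"
      by measurable
    have gY: "(\<lambda>\<omega>. g (Y \<omega>)) -` C \<inter> space M = Y -` ?B \<inter> space M"
      using measurable_space[OF assms(2)] by auto
    have "emeasure M (X -` A \<inter> space M \<inter> (Y -` ?B \<inter> space M)) = emeasure M {\<omega> \<in> space M. X \<omega> \<in> A \<and> Y \<omega> \<in> ?B}"
      by (rule arg_cong[where f = "emeasure M"]) auto
    also have "\<dots> = emeasure M {\<omega> \<in> space M. X \<omega> \<in> A} * emeasure (distr M N2 Y) ?B"
      unfolding Y by (rule prod) (use A B in auto)
    also have "emeasure (distr M N2 Y) ?B = emeasure M (Y -` ?B \<inter> space M)"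
      using B by (subst emeasure_distr) auto
    also have "{\<omega> \<in> space M. X \<omega> \<in> A} = X -` A \<inter> space M"
      by auto
    finally show ?thesis
      unfolding gY by (simp add: emeasure_eq_measure flip: ennreal_mult)
  qed
  \<comment> \<open>Preimages of a sigma-algebra already form one, so independence need only be
    tested on preimages.\<close>
  have sigma: "sigma_sets (space M) {f -` A \<inter> space M | A. A \<in> sets N} = {f -` A \<inter> space M | A. A \<in> sets N}"
    if f: "f \<in> measurable M N" for f :: "'a \<Rightarrow> 'z" and N
  proof -
    have "f \<in> space M \<rightarrow> space N"
      using f by (auto dest: measurable_space)
    thus ?thesis
      using sets.sigma_sets_eq[of "vimage_algebra (space M) f N"] by (simp add: sets_vimage_algebra2)
  qed
  show "indep_rvs M N1 X N3 (\<lambda>\<omega>. g (Y \<omega>))"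
    unfolding indep_rvs_def indep_sets2_eq by (auto simp: sigma indep)
qed

theorem mainTheorem1:
  fixes X :: "real^'p^'n" and y :: "real^'n"
    and M :: "'a measure" and S :: "'a \<Rightarrow> real^'n^'k"
  assumes "prob_space M"
    and "CARD('p) < CARD('n)"
    and "rank X = CARD('p)"
    and "SSR X y > 0"
    and "CARD('k) > CARD('p)"
    and "gaussian_sketch M S"
  shows "indep_rvs M borel (\<lambda>\<omega>. least_squares (S \<omega> ** X) (S \<omega> *v y))
                     borel (\<lambda>\<omega>. SSR (S \<omega> ** X) (S \<omega> *v y)) \<and>
         distr M borel (\<lambda>\<omega>. SSR (S \<omega> ** X) (S \<omega> *v y) / (SSR X y / real CARD('k)))
           = chi_squared (CARD('k) - CARD('p))"
proof -
  interpret prob_space M by fact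
  have X: "inj ((*v) X)"
    using assms(3) by (simp add: full_rank_injective)
  define k where "k = real CARD('k)"
  have k: "k > 0"
    by (simp add: k_def)
  define \<beta> where "\<beta> = least_squares X y"
  define r where "r = y - X *v \<beta>"
  have SSR_F: "SSR X y = (norm r)\<^sup>2"
    by (simp add: SSR_eq_norm[OF X] r_def \<beta>_def)
  hence r: "norm r > 0"
    using assms(4) by (cases "r = 0") auto
  define e where "e = (1 / norm r) *\<^sub>R r"
  \<comment> \<open>The factor \<open>1 / sqrt k\<close> is moved from the sketch into the design
    \<open>X'\<close> and the noise level \<open>c\<close>, leaving a standard Gaussian matrix as
    the only randomness.\<close>
  define X' where "X' = (1 / sqrt k) *\<^sub>R X"
  define c where "c = norm r / sqrt k"
  have c: "c \<noteq> 0" "c\<^sup>2 = SSR X y / k"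
    using r k by (simp_all add: c_def SSR_F power_divide)
  have e: "norm e = 1"
    using r by (simp add: e_def)
  have "transpose X *v r = 0"
    using residual_orthogonal[OF X, of y] by (simp add: r_def \<beta>_def)
  hence e': "transpose X' *v e = 0"
    by (simp del: transpose_matrix_vector add: e_def X'_def transpose_scalar matrix_vector_mult_scaleR
        flip: scaleR_matrix_vector_assoc)
  have X': "inj ((*v) X')"
    using X k by (auto simp: X'_def inj_on_def simp flip: scaleR_matrix_vector_assoc)

  define m :: "real^('k\<times>'n) \<Rightarrow> real^'n^'k" where "m s = (\<chi> i j. s $ (i, j))" for s
  \<comment> \<open>The sketch rescaled to unit variance and flattened to a vector indexed by
    pairs.\<close>
  define T where "T \<omega> = (\<chi> ij. sqrt k * S \<omega> $ fst ij $ snd ij)" for \<omega>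
  have S: "S \<omega> = (1 / sqrt k) *\<^sub>R m (T \<omega>)" for \<omega>
    using k by (simp add: m_def T_def vec_eq_iff)
  have [measurable]: "m \<in> borel_measurable borel"
    unfolding m_def by measurable
  have sketch: "indep_vars (\<lambda>_. borel) (\<lambda>(i, j) \<omega>. S \<omega> $ i $ j) UNIV"
      "distributed M lborel (\<lambda>\<omega>. S \<omega> $ i $ j) (normal_density 0 (sqrt (1 / k)))" for i j
    using assms(6) by (auto simp: gaussian_sketch_def k_def)
  have T_std: "distr M borel T = std_gaussian"
  proof (rule distr_eq_std_gaussian)
    have "indep_vars (\<lambda>_. borel) (\<lambda>ij. (\<lambda>x. sqrt k * x) \<circ> (\<lambda>(i, j) \<omega>. S \<omega> $ i $ j) ij) UNIV"
      by (rule indep_vars_compose[OF sketch(1)]) auto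
    thus "indep_vars (\<lambda>_. borel) (\<lambda>ij \<omega>. T \<omega> $ ij) UNIV"
      by (simp add: T_def o_def case_prod_unfold)
  next
    fix ij :: "'k \<times> 'n"
    have "distributed M lborel (\<lambda>\<omega>. 0 + sqrt k * S \<omega> $ fst ij $ snd ij)
        (normal_density (0 + sqrt k * 0) (\<bar>sqrt k\<bar> * sqrt (1 / k)))"
      using k by (intro normal_density_affine sketch(2)) auto
    thus "distributed M lborel (\<lambda>\<omega>. T \<omega> $ ij) std_normal_density"
      using k by (simp add: T_def real_sqrt_divide)
  qed
  have [measurable]: "T \<in> borel_measurable M"
  proof -
    have "(\<lambda>\<omega>. S \<omega> $ i $ j) \<in> borel_measurable M" for i j
      using sketch(2)[of i j] by (simp add: distributed_def)
    thus ?thesis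
      unfolding T_def by measurable
  qed

  define W where "W s = m s ** X'" for s
  define Z where "Z s = m s *v e" for s
  have [measurable]: "W \<in> borel_measurable borel" "Z \<in> borel_measurable borel"
    unfolding W_def Z_def by measurable
  have SX: "S \<omega> ** X = W (T \<omega>)" for \<omega>
    by (simp add: S W_def X'_def matrix_scalar_ac scalar_matrix_assoc)
  have "y = X *v \<beta> + norm r *\<^sub>R e"
    using r by (simp add: e_def r_def)
  hence "S \<omega> *v y = (S \<omega> ** X) *v \<beta> + norm r *\<^sub>R (S \<omega> *v e)" for \<omega>
    by (simp add: matrix_vector_right_distrib matrix_vector_mult_scaleR matrix_vector_mul_assoc)
  hence Sy: "S \<omega> *v y = W (T \<omega>) *v \<beta> + c *\<^sub>R Z (T \<omega>)" for \<omega>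
    by (simp add: SX) (simp add: S Z_def c_def flip: scaleR_matrix_vector_assoc)

  define \<mu> where "\<mu> = distr std_gaussian borel W"
  have \<mu>: "prob_space \<mu>" "sets \<mu> = sets borel"
    unfolding \<mu>_def by (auto intro!: prob_space.prob_space_distr prob_space_std_gaussian)
  have "AE s in std_gaussian. inj ((*v) (W s))"
    using AE_std_gaussian_full_rank[OF X', where ?'k = 'k] assms(5) by (simp add: W_def m_def)
  hence full_rank: "AE w in \<mu>. inj ((*v) w)"
    unfolding \<mu>_def by (subst AE_distr_iff) (auto simp: inj_iff_det_Gram)
  have WZ: "distr M (borel \<Otimes>\<^sub>M borel) (\<lambda>\<omega>. (W (T \<omega>), Z (T \<omega>))) = \<mu> \<Otimes>\<^sub>M std_gaussian"
  proof -
    have "distr M (borel \<Otimes>\<^sub>M borel) (\<lambda>\<omega>. (W (T \<omega>), Z (T \<omega>)))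
        = distr std_gaussian (borel \<Otimes>\<^sub>M borel) (\<lambda>s. (W s, Z s))"
      unfolding T_std[symmetric] by (subst distr_distr) (auto simp: o_def)
    also have "\<dots> = \<mu> \<Otimes>\<^sub>M std_gaussian"
      using distr_std_gaussian_mult_orthogonal[OF e e', where ?'k = 'k]
      by (simp add: \<mu>_def W_def[abs_def] Z_def m_def)
    finally show ?thesis .
  qed

  define L where "L = (\<lambda>(w::real^'p^'k, z). least_squares w (w *v \<beta> + c *\<^sub>R z))"
  define R where "R = (\<lambda>(w::real^'p^'k, z). SSR w (w *v \<beta> + c *\<^sub>R z) / c\<^sup>2)"
  have [measurable]: "L \<in> borel_measurable (borel \<Otimes>\<^sub>M borel)" "R \<in> borel_measurable (borel \<Otimes>\<^sub>M borel)"
    unfolding L_def R_def by measurable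
  let ?\<chi> = "chi_squared (CARD('k) - CARD('p))"
  let ?L = "\<lambda>\<omega>. L (W (T \<omega>), Z (T \<omega>))" and ?R = "\<lambda>\<omega>. R (W (T \<omega>), Z (T \<omega>))"
  have "distr M (borel \<Otimes>\<^sub>M borel) (\<lambda>\<omega>. (?L \<omega>, ?R \<omega>))
      = distr (\<mu> \<Otimes>\<^sub>M std_gaussian) (borel \<Otimes>\<^sub>M borel) (\<lambda>x. (L x, R x))"
    unfolding WZ[symmetric] by (subst distr_distr) (auto simp: o_def)
  also have "\<dots> = distr (\<mu> \<Otimes>\<^sub>M std_gaussian) borel L \<Otimes>\<^sub>M ?\<chi>"
    using distr_least_squares_SSR_random_design[OF \<mu> full_rank c(1), of \<beta>] by (simp add: L_def R_def)
  also have "distr (\<mu> \<Otimes>\<^sub>M std_gaussian) borel L = distr M borel ?L"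
    unfolding WZ[symmetric] by (subst distr_distr) (auto simp: o_def)
  finally have law: "distr M (borel \<Otimes>\<^sub>M borel) (\<lambda>\<omega>. (?L \<omega>, ?R \<omega>)) = distr M borel ?L \<Otimes>\<^sub>M ?\<chi>" .
  \<comment> \<open>Multiplication by \<open>c\<^sup>2\<close> recovers the sketched residual sum of
    squares from its scaled version \<open>R\<close>.\<close>
  have g: "(\<lambda>x. c\<^sup>2 * x) \<in> borel_measurable (borel :: real measure)"
    by measurable
  have L: "?L \<in> borel_measurable M" and R: "?R \<in> borel_measurable M"
    by measurable
  note * = product_law_imp_indep_rvs[OF L R g prob_space_chi_squared sets_chi_squared law]
  have R_eq: "SSR (S \<omega> ** X) (S \<omega> *v y) / (SSR X y / real CARD('k)) = ?R \<omega>" for \<omega>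
    by (simp add: R_def SX Sy c(2) k_def)
  have "least_squares (S \<omega> ** X) (S \<omega> *v y) = ?L \<omega>" "SSR (S \<omega> ** X) (S \<omega> *v y) = c\<^sup>2 * ?R \<omega>" for \<omega>
    using c(1) by (simp_all add: L_def R_def SX Sy)
  with * show ?thesis
    unfolding R_eq by simp
qed

end
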